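(* Let $n>p>0$ be integers. For all $U\in\mathrm{St}(n,p)$ and all $\delta\in[0,2\sqrt p]$, there is $\widetilde U\in\mathrm{St}(n,p)$ with $\|U-\widetilde U\|_{\mathrm F}=\delta$ such that $$d_{\mathrm E}(U,\widetilde U)=2\sqrt p\,\arcsin\left(\frac{\|U-\widetilde U\|_{\mathrm F}}{2\sqrt p}\right).$$ Hence $\widehat m_{\mathrm E}(\delta)=m_{\mathrm E}(\delta)$ for all $\delta\in[0,2\sqrt p]$.
   Context: The Stiefel manifold is $\mathrm{St}(n,p)=\{U\in\mathbb{R}^{n\times p} : U^TU=I_p\}$, and $\|\cdot\|_{\mathrm F}$ is the Frobenius norm. The Euclidean geodesic distance on $\mathrm{St}(n,p)$ (induced by the metric inherited from $\mathbb{R}^{n\times p}$ with the Frobenius inner product) is $d_{\mathrm E}(U,\widetilde U)=\inf_\gamma\int_0^1\|\dot\gamma(t)\|_{\mathrm F}\,dt$, the infimum being over continuously differentiable curves $\gamma:[0,1]\to\mathrm{St}(n,p)$ with $\gamma(0)=U$, $\gamma(1)=\widetilde U$. For $\delta\in[0,2\sqrt p]$, $m_{\mathrm E}(\delta):=\min\{d_{\mathrm E}(U,\widetilde U) : U,\widetilde U\in\mathrm{St}(n,p),\ \|\widetilde U-U\|_{\mathrm F}=\delta\}$ and $\widehat m_{\mathrm E}(\delta):=2\sqrt p\,\arcsin\left(\frac{\delta}{2\sqrt p}\right)$. *)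

theory Defs
  imports "HOL-Analysis.Analysis"
begin

text \<open>An \<open>n \<times> p\<close> real matrix has type \<open>real^'p^'n\<close> with \<open>n = CARD('n)\<close>, \<open>p = CARD('p)\<close>.
  The library norm (and inner product) on this type is the Frobenius one:\<close>

lemma norm_eq_frobenius:
  fixes A :: "real^'p^'n"
  shows "norm A = sqrt (\<Sum>i\<in>UNIV. \<Sum>j\<in>UNIV. (A $ i $ j)\<^sup>2)"
  by (simp add: norm_vec_def L2_set_def sum_nonneg)

definition stiefel :: "(real^'p^'n) set" where
  "stiefel = {U. transpose U ** U = mat 1}"

text \<open>At the endpoints \<open>0\<close> and \<open>1\<close> the derivative is one-sided.\<close>

definition C1_on_unit :: "(real \<Rightarrow> 'a::real_normed_vector) \<Rightarrow> bool" where
  "C1_on_unit \<gamma> \<longleftrightarrow> \<gamma> differentiable_on {0..1} \<and>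
     continuous_on {0..1} (\<lambda>t. vector_derivative \<gamma> (at t within {0..1}))"

definition curve_length :: "(real \<Rightarrow> 'a::real_normed_vector) \<Rightarrow> real" where
  "curve_length \<gamma> = integral {0..1} (\<lambda>t. norm (vector_derivative \<gamma> (at t within {0..1})))"

definition stiefel_curves :: "real^'p^'n \<Rightarrow> real^'p^'n \<Rightarrow> (real \<Rightarrow> real^'p^'n) set" where
  "stiefel_curves U V =
     {\<gamma>. C1_on_unit \<gamma> \<and> (\<forall>t\<in>{0..1}. \<gamma> t \<in> stiefel) \<and> \<gamma> 0 = U \<and> \<gamma> 1 = V}"

text \<open>The value is extended real so that the infimum over an empty family of curves is
  \<open>\<infinity>\<close>; the infimum of the empty set of type \<open>real\<close> would be an unspecified number.\<close>

definition d_E :: "real^'p^'n \<Rightarrow> real^'p^'n \<Rightarrow> ereal" where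
  "d_E U V = (INF \<gamma>\<in>stiefel_curves U V. ereal (curve_length \<gamma>))"

text \<open>The type arguments carry the dimensions \<open>n\<close> and \<open>p\<close>.\<close>

definition d_E_values :: "'n::finite itself \<Rightarrow> 'p::finite itself \<Rightarrow> real \<Rightarrow> ereal set" where
  "d_E_values N P \<delta> =
     {d_E U V | U V :: real^'p^'n. U \<in> stiefel \<and> V \<in> stiefel \<and> norm (V - U) = \<delta>}"

text \<open>A minimum rather than an infimum: the value is meaningful only where the set has a least
  element.\<close>

definition m_E :: "'n::finite itself \<Rightarrow> 'p::finite itself \<Rightarrow> real \<Rightarrow> ereal" where
  "m_E N P \<delta> = (LEAST d. d \<in> d_E_values N P \<delta>)"

definition m_hat_E :: "nat \<Rightarrow> real \<Rightarrow> real" where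
  "m_hat_E p \<delta> = 2 * sqrt (real p) * arcsin (\<delta> / (2 * sqrt (real p)))"

end

theory Submission
  imports Defs
begin

text \<open>Every Stiefel matrix has Frobenius norm \<open>\<surd>p\<close>, so a curve in the Stiefel manifold is a curve on a
  sphere of radius \<open>\<surd>p\<close> and is at least as long as the great circle arc between its end points.
  The bound is attained when the great circle \<open>cos x \<cdot> U + sin x \<cdot> W\<close> stays in the Stiefel manifold,
  which happens as soon as \<open>W\<close> is a Stiefel matrix with \<open>U\<^sup>T W\<close> skew-symmetric.
  Such a \<open>W\<close> exists for every \<open>U\<close> because \<open>n > p\<close>.\<close>

section \<open>Length of curves on a sphere\<close>

text \<open>The angle between \<open>\<gamma> 0\<close> and \<open>\<gamma> t\<close> grows at rate
  at most the speed divided by \<open>r\<close>; integrating this rate gives the bound.\<close>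

lemma length_ge_sphere_arc:
  fixes \<gamma> :: "real \<Rightarrow> 'a::euclidean_space"
  assumes C1: "C1_on_unit \<gamma>" and r: "0 < r"
    and sphere: "\<And>t. t \<in> {0..1} \<Longrightarrow> norm (\<gamma> t) = r"
  shows "r * arccos (\<gamma> 0 \<bullet> \<gamma> 1 / r\<^sup>2) \<le> curve_length \<gamma>"
proof -
  define \<gamma>' where "\<gamma>' = (\<lambda>t. vector_derivative \<gamma> (at t within {0..1}))"
  define f where "f = (\<lambda>t. \<gamma> 0 \<bullet> \<gamma> t / r\<^sup>2)"
  have d\<gamma>: "(\<gamma> has_vector_derivative \<gamma>' t) (at t within {0..1})" if "t \<in> {0..1}" for t
    using C1 that unfolding C1_on_unit_def \<gamma>'_def differentiable_on_def
    by (metis vector_derivative_works)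
  have inner_self: "\<gamma> t \<bullet> \<gamma> t = r\<^sup>2" if "t \<in> {0..1}" for t
    using sphere[OF that] by (simp add: dot_square_norm)
  have tangent: "\<gamma> t \<bullet> \<gamma>' t = 0" if t: "t \<in> {0..1}" for t
  proof -
    have "((\<lambda>s. \<gamma> s \<bullet> \<gamma> s) has_vector_derivative \<gamma> t \<bullet> \<gamma>' t + \<gamma>' t \<bullet> \<gamma> t) (at t within {0..1})"
      by (rule bounded_bilinear.has_vector_derivative[OF bounded_bilinear_inner d\<gamma>[OF t] d\<gamma>[OF t]])
    moreover have "((\<lambda>s. \<gamma> s \<bullet> \<gamma> s) has_vector_derivative 0) (at t within {0..1})"
      by (rule has_vector_derivative_transform[OF t _ has_vector_derivative_const[of "r\<^sup>2"]])
         (simp add: inner_self)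
    ultimately have "\<gamma> t \<bullet> \<gamma>' t + \<gamma>' t \<bullet> \<gamma> t = 0"
      using vector_derivative_unique_within_closed_interval[of 0 1 t] t
      by fastforce
    then show ?thesis by (simp add: inner_commute)
  qed
  have f_le_1: "\<bar>f t\<bar> \<le> 1" if "t \<in> {0..1}" for t
    using Cauchy_Schwarz_ineq2[of "\<gamma> 0" "\<gamma> t"] sphere[of 0] sphere[OF that] r
    by (simp add: f_def abs_mult divide_le_eq power2_eq_square)
  have df: "(f has_real_derivative \<gamma> 0 \<bullet> \<gamma>' t / r\<^sup>2) (at t within {0..1})"
    if t: "t \<in> {0..1}" for t
    unfolding f_def has_real_derivative_iff_has_vector_derivative
    using bounded_linear.has_vector_derivative[OF bounded_linear_divide
        bounded_linear.has_vector_derivative[OF bounded_linear_inner_right d\<gamma>[OF t], of "\<gamma> 0"], of "r\<^sup>2"]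
    by simp
  have speed: "\<bar>\<gamma> 0 \<bullet> \<gamma>' t / r\<^sup>2\<bar> \<le> sqrt (1 - (f t)\<^sup>2) * norm (\<gamma>' t) / r"
    if t: "t \<in> {0..1}" for t
  proof -
    \<comment> \<open>\<open>w\<close> is the part of \<open>\<gamma> 0\<close> orthogonal to
      \<open>\<gamma> t\<close>. The velocity is tangent and sees only this part, which yields the
      factor that cancels the derivative of \<open>arccos\<close>.\<close>
    define w where "w = \<gamma> 0 - f t *\<^sub>R \<gamma> t"
    have "w \<bullet> \<gamma>' t = \<gamma> 0 \<bullet> \<gamma>' t"
      using tangent[OF t] by (simp add: w_def inner_diff_left)
    moreover have "norm w = r * sqrt (1 - (f t)\<^sup>2)"
    proof -
      have *: "\<gamma> 0 \<bullet> \<gamma> t = r\<^sup>2 * f t" using r by (simp add: f_def)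
      have "w \<bullet> w = r\<^sup>2 * (1 - (f t)\<^sup>2)"
        unfolding w_def using inner_self[of 0] inner_self[OF t] *
        by (simp add: inner_diff_left inner_diff_right inner_commute[of "\<gamma> t" "\<gamma> 0"]
            algebra_simps power2_eq_square)
      then show ?thesis using r by (simp add: norm_eq_sqrt_inner real_sqrt_mult)
    qed
    ultimately have "\<bar>\<gamma> 0 \<bullet> \<gamma>' t\<bar> \<le> r * sqrt (1 - (f t)\<^sup>2) * norm (\<gamma>' t)"
      using Cauchy_Schwarz_ineq2[of w "\<gamma>' t"] by simp
    then show ?thesis using r by (simp add: divide_simps power2_eq_square mult.commute mult.left_commute)
  qed
  have int: "((\<lambda>t. norm (\<gamma>' t) / r) has_integral curve_length \<gamma> / r) {0..1}"
  proof -
    have "continuous_on {0..1} (\<lambda>t. norm (\<gamma>' t))"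
      using C1 unfolding C1_on_unit_def \<gamma>'_def by (intro continuous_on_norm) simp
    then have "((\<lambda>t. norm (\<gamma>' t)) has_integral curve_length \<gamma>) {0..1}"
      unfolding curve_length_def \<gamma>'_def
      by (intro integrable_integral integrable_continuous_interval)
    from has_integral_divide[OF this] show ?thesis .
  qed
  \<comment> \<open>\<open>arccos\<close> is not differentiable at \<open>\<plusminus>1\<close>, so \<open>f\<close> is shrunk by a factor \<open>c < 1\<close>,
    which does not increase the derivative bound.\<close>
  have shrunk: "arccos (c * f 1) - arccos c \<le> curve_length \<gamma> / r" if c: "c \<in> {0<..<1}" for c
  proof -
    define D where "D = (\<lambda>t. inverse (- sqrt (1 - (c * f t)\<^sup>2)) * (c * (\<gamma> 0 \<bullet> \<gamma>' t / r\<^sup>2)))"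
    have cf: "\<bar>c * f t\<bar> < 1" if t: "t \<in> {0..1}" for t
    proof -
      have "\<bar>c * f t\<bar> \<le> c * 1"
        unfolding abs_mult using c f_le_1[OF t] by (intro mult_mono) auto
      then show ?thesis using c by simp
    qed
    have dphi: "((\<lambda>t. arccos (c * f t)) has_vector_derivative D t) (at t within {0..1})"
      if t: "t \<in> {0..1}" for t
      unfolding has_real_derivative_iff_has_vector_derivative[symmetric] D_def
      using cf[OF t]
      by (intro DERIV_chain2[OF DERIV_arccos] DERIV_cmult df[OF t]) auto
    have "(D has_integral arccos (c * f 1) - arccos (c * f 0)) {0..1}"
      by (rule fundamental_theorem_of_calculus) (use dphi in auto)
    moreover have "D t \<le> norm (\<gamma>' t) / r" if t: "t \<in> {0..1}" for t
    proof -
      define q where "q = sqrt (1 - (c * f t)\<^sup>2)"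
      have "(c * f t)\<^sup>2 < 1" using cf[OF t] by (simp add: abs_square_less_1)
      then have q: "q > 0" by (simp add: q_def)
      \<comment> \<open>Under the roots the comparison is
        \<open>c\<^sup>2 - (c * f t)\<^sup>2 \<le> 1 - (c * f t)\<^sup>2\<close>.\<close>
      have "c * sqrt (1 - (f t)\<^sup>2) = sqrt (c\<^sup>2 * (1 - (f t)\<^sup>2))"
        using c by (simp add: real_sqrt_mult)
      also have "\<dots> \<le> q"
        unfolding q_def using c by (simp add: power_le_one power_mult_distrib right_diff_distrib)
      finally have cq: "c * sqrt (1 - (f t)\<^sup>2) \<le> q" .
      have "D t \<le> \<bar>D t\<bar>" by simp
      also have "\<bar>D t\<bar> = c * \<bar>\<gamma> 0 \<bullet> \<gamma>' t / r\<^sup>2\<bar> / q"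
        unfolding D_def q_def[symmetric] using q c by (simp add: abs_mult field_simps)
      also have "\<dots> \<le> c * (sqrt (1 - (f t)\<^sup>2) * norm (\<gamma>' t) / r) / q"
        using speed[OF t] q c by (intro divide_right_mono mult_left_mono) auto
      also have "\<dots> = (c * sqrt (1 - (f t)\<^sup>2)) * (norm (\<gamma>' t) / r / q)" by simp
      also have "\<dots> \<le> q * (norm (\<gamma>' t) / r / q)"
        using q r by (intro mult_right_mono[OF cq]) auto
      also have "\<dots> = norm (\<gamma>' t) / r" using q by simp
      finally show ?thesis .
    qed
    ultimately have "arccos (c * f 1) - arccos (c * f 0) \<le> curve_length \<gamma> / r"
      using has_integral_le[OF _ int] by blast
    moreover have "f 0 = 1" using inner_self[of 0] r by (simp add: f_def)
    ultimately show ?thesis by simp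
  qed
  \<comment> \<open>Let \<open>c\<close> tend to 1 from the left: \<open>arccos\<close> is
    continuous up to the end points of its domain, so the bound survives.\<close>
  have "arccos (f 1) - arccos 1 \<le> curve_length \<gamma> / r"
  proof (rule tendsto_upperbound)
    have "continuous_on {0..1} (\<lambda>c. arccos (c * f 1) - arccos c)"
    proof (intro continuous_intros ballI)
      fix c :: real assume c: "c \<in> {0..1}"
      have "\<bar>c * f 1\<bar> \<le> 1 * 1"
        unfolding abs_mult using c f_le_1[of 1] by (intro mult_mono) auto
      then show "- 1 \<le> c * f 1 \<and> c * f 1 \<le> 1" "- 1 \<le> c \<and> c \<le> 1" using c by auto
    qed
    then have "((\<lambda>c. arccos (c * f 1) - arccos c) \<longlongrightarrow> arccos (1 * f 1) - arccos 1) (at 1 within {0..1})"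
      unfolding continuous_on_def by (rule bspec) simp
    then show "((\<lambda>c. arccos (c * f 1) - arccos c) \<longlongrightarrow> arccos (f 1) - arccos 1) (at_left 1)"
      unfolding at_within_Icc_at_left[OF zero_less_one] mult_1 .
    show "\<forall>\<^sub>F c in at_left 1. arccos (c * f 1) - arccos c \<le> curve_length \<gamma> / r"
      by (rule eventually_mono[OF eventually_at_left_real[of 0 1]]) (simp_all add: shrunk)
  qed auto
  then show ?thesis using r by (simp add: f_def field_simps)
qed

text \<open>Translates angles into chords: on a sphere of radius \<open>r\<close>, a chord of length
  \<open>2 * r * s\<close> subtends an angle with cosine \<open>1 - 2 * s\<^sup>2\<close>.\<close>

lemma arccos_one_minus_twice_square:
  fixes s :: real
  assumes "0 \<le> s" "s \<le> 1"
  shows "arccos (1 - 2 * s\<^sup>2) = 2 * arcsin s"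
proof -
  have "cos (2 * arcsin s) = 1 - 2 * s\<^sup>2"
    using assms by (simp add: cos_double_sin)
  moreover have "0 \<le> 2 * arcsin s" "2 * arcsin s \<le> pi"
    using assms arcsin_le_arcsin[of 0 s] arcsin_ubound[of s] by auto
  ultimately show ?thesis by (metis arccos_cos)
qed

section \<open>Stiefel matrices by columns, and the lower bound for the distance\<close>

lemma stiefel_iff_columns:
  fixes U :: "real^'p^'n"
  shows "U \<in> stiefel \<longleftrightarrow> (\<forall>i j. column i U \<bullet> column j U = (if i = j then 1 else 0))"
  unfolding stiefel_def
  by (simp add: vec_eq_iff matrix_matrix_mult_def transpose_def mat_def column_def inner_vec_def)

lemma inner_eq_sum_columns:
  fixes A B :: "real^'p^'n"
  shows "A \<bullet> B = (\<Sum>j\<in>UNIV. column j A \<bullet> column j B)"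
  unfolding inner_vec_def column_def by (simp, rule sum.swap)

lemma norm_stiefel:
  fixes U :: "real^'p^'n"
  assumes "U \<in> stiefel"
  shows "norm U = sqrt (real CARD('p))"
proof -
  have "U \<bullet> U = real CARD('p)"
    using assms by (simp add: stiefel_iff_columns inner_eq_sum_columns)
  then show ?thesis by (simp add: norm_eq_sqrt_inner)
qed

text \<open>The arc bound on the sphere of radius \<open>sqrt p\<close>, expressed through the
  chord. It includes the case of no connecting curve, where \<open>d_E U V\<close> is
  infinite.\<close>

lemma d_E_ge:
  fixes U V :: "real^'p^'n"
  assumes U: "U \<in> stiefel" and V: "V \<in> stiefel"
  shows "ereal (m_hat_E CARD('p) (norm (U - V))) \<le> d_E U V"
  unfolding d_E_def
proof (rule INF_greatest)
  fix \<gamma> assume \<gamma>: "\<gamma> \<in> stiefel_curves U V"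
  define r where "r = sqrt (real CARD('p))"
  have r: "r > 0" by (simp add: r_def)
  define s where "s = norm (U - V) / (2 * r)"
  have nU: "norm U = r" and nV: "norm V = r"
    using norm_stiefel U V by (auto simp: r_def)
  \<comment> \<open>Points of the sphere are at most a diameter \<open>2 * r\<close> apart.\<close>
  have s: "0 \<le> s" "s \<le> 1"
    using norm_triangle_ineq4[of U V] nU nV r by (auto simp: s_def divide_le_eq)
  have "(norm (U - V))\<^sup>2 = 2 * r\<^sup>2 - 2 * (U \<bullet> V)"
    unfolding power2_norm_eq_inner inner_diff_left inner_diff_right
    using nU nV by (simp add: dot_square_norm inner_commute[of V U])
  then have "U \<bullet> V / r\<^sup>2 = 1 - 2 * s\<^sup>2"
    using r by (simp add: s_def power_divide power_mult_distrib field_simps)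
  moreover have "r * arccos (\<gamma> 0 \<bullet> \<gamma> 1 / r\<^sup>2) \<le> curve_length \<gamma>"
    using \<gamma> by (intro length_ge_sphere_arc r) (auto simp: stiefel_curves_def r_def norm_stiefel)
  ultimately show "ereal (m_hat_E CARD('p) (norm (U - V))) \<le> ereal (curve_length \<gamma>)"
    using \<gamma> arccos_one_minus_twice_square[OF s]
    by (simp add: stiefel_curves_def m_hat_E_def r_def s_def)
qed

section \<open>Great circles inside the Stiefel manifold\<close>

text \<open>The columns span at most \<open>p < n\<close> dimensions, so a nonzero vector is
  orthogonal to all of them.\<close>

lemma exists_unit_orthogonal_columns:
  fixes U :: "real^'p^'n"
  assumes "CARD('n) > CARD('p)"
  obtains x where "x \<bullet> x = 1" "\<And>j. x \<bullet> column j U = 0"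
proof -
  have "dim (columns U) \<le> CARD('p)"
  proof -
    have "columns U = range (\<lambda>j. column j U)" by (auto simp: columns_def)
    then show ?thesis
      by (metis card_image_le dim_le_card' finite finite_imageI le_trans)
  qed
  then have "dim (columns U) < DIM(real^'n)" using assms by simp
  then obtain x where x: "x \<noteq> 0" "\<And>y. y \<in> span (columns U) \<Longrightarrow> orthogonal x y"
    using orthogonal_to_subspace_exists by blast
  have "x \<bullet> column j U = 0" for j
    using x(2)[OF span_base] by (auto simp: columns_def orthogonal_def)
  then show thesis
    using x(1) by (intro that[of "x /\<^sub>R norm x"]) (auto simp: dot_square_norm power2_eq_square field_simps)
qed

text \<open>The columns \<open>e\<^sub>0, \<dots>, e\<^sub>p\<^sub>-\<^sub>1\<close> of \<open>U\<close> and one further unit vector \<open>e\<^sub>p\<close> orthogonal to them (only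
  needed for odd \<open>p\<close>) are grouped in consecutive pairs, and each pair is rotated by a right angle.\<close>

lemma exists_stiefel_skew:
  fixes U :: "real^'p^'n"
  assumes card: "CARD('n) > CARD('p)" and U: "U \<in> stiefel"
  obtains W :: "real^'p^'n" where "W \<in> stiefel"
    "\<And>i j. column i U \<bullet> column j W + column i W \<bullet> column j U = 0"
proof -
  obtain x where x: "x \<bullet> x = 1" "\<And>j. x \<bullet> column j U = 0"
    using exists_unit_orthogonal_columns[OF card] by blast
  obtain h :: "'p \<Rightarrow> nat" where h: "bij_betw h UNIV {0..<CARD('p)}"
    using ex_bij_betw_finite_nat[of "UNIV :: 'p set"] by auto
  have inj: "h i = h j \<longleftrightarrow> i = j" for i j
    using h by (auto simp: bij_betw_def inj_on_def)
  have less: "h i < CARD('p)" for i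
    using h by (auto simp: bij_betw_def)
  define e where "e k = (if k < CARD('p) then column (inv h k) U else x)" for k
  have e_h: "e (h j) = column j U" for j
    using less inj by (simp add: e_def inv_f_f inj_def)
  have e: "e i \<bullet> e j = (if i = j then 1 else 0)" if "i \<le> CARD('p)" "j \<le> CARD('p)" for i j
  proof -
    have "inv h i = inv h j \<longleftrightarrow> i = j" if "i < CARD('p)" "j < CARD('p)" for i j
      using h that by (metis atLeast0LessThan bij_betw_imp_surj_on f_inv_into_f lessThan_iff)
    then show ?thesis
      using that U x by (auto simp: e_def stiefel_iff_columns inner_commute)
  qed
  \<comment> \<open>Even \<open>k\<close> is paired with \<open>k + 1\<close>. For odd
    \<open>p\<close> the last index \<open>p - 1\<close> is paired with \<open>p\<close>, where
    \<open>e\<close> is \<open>x\<close>; hence \<open>e\<close> is orthonormal up to and including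
    index \<open>p\<close>.\<close>
  define w where "w k = (if even k then e (k + 1) else - e (k - 1))" for k
  define W :: "real^'p^'n" where "W = (\<chi> i j. w (h j) $ i)"
  have W: "column j W = w (h j)" for j
    by (simp add: W_def column_def vec_eq_iff)
  have ww: "w i \<bullet> w j = (if i = j then 1 else 0)" if "i < CARD('p)" "j < CARD('p)" for i j
    using that by (auto simp: w_def e) presburger+
  \<comment> \<open>Nonzero products occur only when \<open>i\<close> and \<open>j\<close> form a
    pair; they are then 1 and -1.\<close>
  have ew: "e i \<bullet> w j + w i \<bullet> e j = 0" if "i < CARD('p)" "j < CARD('p)" for i j
    using that by (auto simp: w_def e)
  show thesis
  proof (rule that)
    show "W \<in> stiefel"
      by (simp add: stiefel_iff_columns W ww less inj)
    show "column i U \<bullet> column j W + column i W \<bullet> column j U = 0" for i j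
      using ew[OF less less, of i j] by (simp add: W e_h)
  qed
qed

text \<open>In the Gram matrix the two squared terms add up to the identity, and the mixed term is a
  multiple of the symmetric part of \<open>U\<^sup>T W\<close>, which vanishes.\<close>

lemma great_circle_in_stiefel:
  fixes U W :: "real^'p^'n"
  assumes "U \<in> stiefel" "W \<in> stiefel"
    "\<And>i j. column i U \<bullet> column j W + column i W \<bullet> column j U = 0"
  shows "cos x *\<^sub>R U + sin x *\<^sub>R W \<in> stiefel"
proof -
  have col: "column i (cos x *\<^sub>R U + sin x *\<^sub>R W) = cos x *\<^sub>R column i U + sin x *\<^sub>R column i W" for i
    by (simp add: column_def vec_eq_iff)
  have "column i (cos x *\<^sub>R U + sin x *\<^sub>R W) \<bullet> column j (cos x *\<^sub>R U + sin x *\<^sub>R W)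
      = (if i = j then 1 else 0)" for i j
  proof -
    have "column i (cos x *\<^sub>R U + sin x *\<^sub>R W) \<bullet> column j (cos x *\<^sub>R U + sin x *\<^sub>R W)
      = (cos x)\<^sup>2 * (column i U \<bullet> column j U) + (sin x)\<^sup>2 * (column i W \<bullet> column j W)
        + cos x * sin x * (column i U \<bullet> column j W + column i W \<bullet> column j U)"
      unfolding col by (simp add: inner_add_left inner_add_right power2_eq_square algebra_simps)
    then show ?thesis using assms by (simp add: stiefel_iff_columns)
  qed
  then show ?thesis by (simp add: stiefel_iff_columns)
qed

section \<open>Attaining the bound\<close>

text \<open>An arc of such a great circle, run at constant speed, has exactly the length demanded by
  \<open>d_E_ge\<close>.\<close>

lemma exists_d_E_eq_m_hat_E:
  fixes U :: "real^'p^'n"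
  assumes card: "CARD('n) > CARD('p)" and U: "U \<in> stiefel"
    and \<delta>: "0 \<le> \<delta>" "\<delta> \<le> 2 * sqrt (real CARD('p))"
  obtains V where "V \<in> stiefel" "norm (U - V) = \<delta>" "d_E U V = ereal (m_hat_E CARD('p) \<delta>)"
proof -
  obtain W :: "real^'p^'n" where W: "W \<in> stiefel"
    "\<And>i j. column i U \<bullet> column j W + column i W \<bullet> column j U = 0"
    using exists_stiefel_skew[OF card U] by blast
  define r where "r = sqrt (real CARD('p))"
  have r: "r > 0" by (simp add: r_def)
  define s where "s = \<delta> / (2 * r)"
  have s: "0 \<le> s" "s \<le> 1" using \<delta> r by (auto simp: s_def r_def[symmetric])
  \<comment> \<open>Chosen so that the chord \<open>2 * r * sin (\<theta> / 2)\<close> equals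
    \<open>\<delta>\<close>.\<close>
  define \<theta> where "\<theta> = 2 * arcsin s"
  have \<theta>: "\<theta> \<ge> 0" using s arcsin_le_arcsin[of 0 s] by (simp add: \<theta>_def)
  define g where "g x = cos x *\<^sub>R U + sin x *\<^sub>R W" for x
  have g: "g x \<in> stiefel" for x
    unfolding g_def by (rule great_circle_in_stiefel[OF U W])
  define \<gamma> where "\<gamma> t = g (\<theta> * t)" for t
  \<comment> \<open>Differentiating \<open>g\<close> shifts its argument by a quarter turn, so the
    velocity is \<open>\<theta>\<close> times a Stiefel matrix and the speed is
    \<open>\<theta> * r\<close>.\<close>
  define \<gamma>' where "\<gamma>' t = \<theta> *\<^sub>R g (\<theta> * t + pi / 2)" for t
  have d\<gamma>: "(\<gamma> has_vector_derivative \<gamma>' t) (at t within {0..1})" for t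
    unfolding \<gamma>_def \<gamma>'_def g_def
    by (auto intro!: derivative_eq_intros simp: cos_add sin_add algebra_simps)
  have vd: "vector_derivative \<gamma> (at t within {0..1}) = \<gamma>' t" if "t \<in> {0..1}" for t
    by (rule vector_derivative_within_closed_interval) (use that d\<gamma> in auto)
  have "continuous_on {0..1} \<gamma>'"
    unfolding \<gamma>'_def g_def by (intro continuous_intros)
  then have "C1_on_unit \<gamma>"
    unfolding C1_on_unit_def differentiable_on_def
    using d\<gamma> vd by (metis (no_types, lifting) continuous_on_cong differentiableI_vector)
  then have curve: "\<gamma> \<in> stiefel_curves U (g \<theta>)"
    using g by (simp add: stiefel_curves_def \<gamma>_def) (simp add: g_def)
  have "curve_length \<gamma> = integral {0..1} (\<lambda>t::real. \<theta> * r)"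
    unfolding curve_length_def
    by (rule integral_cong) (use \<theta> norm_stiefel[OF g] in \<open>simp add: vd \<gamma>'_def r_def\<close>)
  then have len: "curve_length \<gamma> = m_hat_E CARD('p) \<delta>"
    by (simp add: m_hat_E_def \<theta>_def r_def s_def)
  have "norm (U - g \<theta>) = \<delta>"
  proof -
    \<comment> \<open>The Frobenius product is the trace of the skew matrix
      \<open>U\<^sup>T W\<close>.\<close>
    have UW: "U \<bullet> W = 0"
      using W(2)[of j j for j] by (simp add: inner_eq_sum_columns inner_commute)
    have self: "U \<bullet> U = r\<^sup>2" "W \<bullet> W = r\<^sup>2"
      using norm_stiefel[OF U] norm_stiefel[OF W(1)] by (simp_all add: r_def dot_square_norm)
    have diff: "U - g \<theta> = (1 - cos \<theta>) *\<^sub>R U - sin \<theta> *\<^sub>R W"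
      by (simp add: g_def algebra_simps)
    have "(norm (U - g \<theta>))\<^sup>2 = ((1 - cos \<theta>)\<^sup>2 + (sin \<theta>)\<^sup>2) * r\<^sup>2"
      unfolding diff power2_norm_eq_inner inner_diff_left inner_diff_right inner_scaleR_left inner_scaleR_right
      using UW self by (simp add: inner_commute[of W U] power2_eq_square distrib_right mult.assoc)
    also have "(1 - cos \<theta>)\<^sup>2 + (sin \<theta>)\<^sup>2 = 2 * (1 - cos \<theta>)"
      by (simp add: sin_squared_eq power2_eq_square algebra_simps)
    also have "cos \<theta> = 1 - 2 * s\<^sup>2"
      using s by (simp add: \<theta>_def cos_double_sin)
    also have "2 * (1 - (1 - 2 * s\<^sup>2)) * r\<^sup>2 = \<delta>\<^sup>2"
      using r by (simp add: s_def power_divide power_mult_distrib)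
    finally show ?thesis using \<delta> by simp
  qed
  moreover from this have "d_E U (g \<theta>) = ereal (m_hat_E CARD('p) \<delta>)"
    using d_E_ge[OF U g, of \<theta>] INF_lower[OF curve, of "\<lambda>\<gamma>. ereal (curve_length \<gamma>)"] len
    by (simp add: d_E_def antisym)
  ultimately show thesis using that g by blast
qed

text \<open>Distinct standard basis vectors serve as columns. This supplies a starting point
  \<open>U\<close> for the minimum.\<close>

lemma stiefel_nonempty:
  assumes "CARD('n::finite) \<ge> CARD('p::finite)"
  shows "(stiefel :: (real^'p^'n) set) \<noteq> {}"
proof -
  obtain f :: "'p \<Rightarrow> 'n" where f: "inj f"
    using assms card_le_inj[of "UNIV::'p set" "UNIV::'n set"] by auto
  define U :: "real^'p^'n" where "U = (\<chi> i j. axis (f j) 1 $ i)"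
  have "column j U = axis (f j) 1" for j
    by (simp add: U_def column_def vec_eq_iff)
  then have "U \<in> stiefel"
    using f by (auto simp: stiefel_iff_columns inner_axis_axis inj_def)
  then show ?thesis by blast
qed

theorem corollary6p12:
  assumes "CARD('n::finite) > CARD('p::finite)"
  shows "(\<forall>U \<in> (stiefel :: (real^'p^'n) set). \<forall>\<delta> \<in> {0 .. 2 * sqrt (real CARD('p))}.
            \<exists>V \<in> stiefel. norm (U - V) = \<delta> \<and>
              d_E U V = ereal (2 * sqrt (real CARD('p)) *
                          arcsin (norm (U - V) / (2 * sqrt (real CARD('p))))))
       \<and> (\<forall>\<delta> \<in> {0 .. 2 * sqrt (real CARD('p))}.
            m_E TYPE('n) TYPE('p) \<delta> \<in> d_E_values TYPE('n) TYPE('p) \<delta> \<and>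
            (\<forall>d \<in> d_E_values TYPE('n) TYPE('p) \<delta>. m_E TYPE('n) TYPE('p) \<delta> \<le> d) \<and>
            ereal (m_hat_E CARD('p) \<delta>) = m_E TYPE('n) TYPE('p) \<delta>)"
proof (intro conjI ballI)
  fix U :: "real^'p^'n" and \<delta>
  assume "U \<in> stiefel" "\<delta> \<in> {0 .. 2 * sqrt (real CARD('p))}"
  then obtain V where "V \<in> stiefel" "norm (U - V) = \<delta>" "d_E U V = ereal (m_hat_E CARD('p) \<delta>)"
    using exists_d_E_eq_m_hat_E[OF assms, of U \<delta>] by auto
  then show "\<exists>V \<in> stiefel. norm (U - V) = \<delta> \<and>
      d_E U V = ereal (2 * sqrt (real CARD('p)) * arcsin (norm (U - V) / (2 * sqrt (real CARD('p)))))"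
    unfolding m_hat_E_def by blast
next
  fix \<delta> assume \<delta>: "\<delta> \<in> {0 .. 2 * sqrt (real CARD('p))}"
  let ?D = "d_E_values TYPE('n) TYPE('p) \<delta>" and ?m = "ereal (m_hat_E CARD('p) \<delta>)"
  obtain U :: "real^'p^'n" where U: "U \<in> stiefel"
    using stiefel_nonempty[where 'n='n and 'p='p] assms by force
  have mem: "?m \<in> ?D"
    using exists_d_E_eq_m_hat_E[OF assms U, of \<delta>] U \<delta>
    unfolding d_E_values_def by (smt (verit) atLeastAtMost_iff mem_Collect_eq norm_minus_commute)
  have least: "?m \<le> d" if "d \<in> ?D" for d
    using that d_E_ge unfolding d_E_values_def by (force simp: norm_minus_commute)
  \<comment> \<open>\<open>LEAST\<close> is pinned down by exhibiting a member of the set that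
    bounds it from below.\<close>
  have "m_E TYPE('n) TYPE('p) \<delta> = ?m"
    unfolding m_E_def using mem least by (rule Least_equality)
  then show "m_E TYPE('n) TYPE('p) \<delta> \<in> ?D" "?m = m_E TYPE('n) TYPE('p) \<delta>"
    "\<And>d. d \<in> ?D \<Longrightarrow> m_E TYPE('n) TYPE('p) \<delta> \<le> d"
    using mem least by simp_all
qed

end
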